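(* Let $R$ be a commutative ring with identity and let $N$ be a weakly $J$-submodule of an $R$-module $M$ such that $N\subseteq J(R)M$. If $N$ is not a $J$-submodule of $M$, then $(N:M)N=0$. In particular (in this case), $(N:M)^{2}\subseteq \mathrm{Ann}(M)$. Hence a weakly $J$-submodule $N\subseteq J(R)M$ with $(N:M)N\neq 0$ is a $J$-submodule.
   Context: Rings are commutative with identity and modules are unital. $J(R)$ is the Jacobson radical of $R$ (intersection of all maximal ideals). For a submodule $N$ of an $R$-module $M$, $(N:M)=\{r\in R: rM\subseteq N\}$, and $\mathrm{Ann}(M)=(0:M)$. A proper submodule $N$ of $M$ is a $J$-submodule if whenever $r\in R$, $m\in M$ satisfy $rm\in N$ and $r\notin (J(R)M:M)$, then $m\in N$. A proper submodule $N$ of $M$ is a weakly $J$-submodule if whenever $r\in R$, $m\in M$ satisfy $0\neq rm\in N$ and $r\notin (J(R)M:M)$, then $m\in N$. *)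

theory Defs
  imports HOL.Hull "HOL-Algebra.Ideal_Product" "HOL-Algebra.Module"
begin

text \<open>The intersection is taken inside the carrier, so the radical of the zero ring,
  which has no maximal ideals, is the whole ring.\<close>

definition jacobson_radical :: "('r, 'a) ring_scheme \<Rightarrow> 'r set" where
  "jacobson_radical R = carrier R \<inter> \<Inter>{I. maximalideal I R}"

text \<open>The product \<open>I N\<close> of an ideal and a submodule is the submodule generated by all
  products \<open>a x\<close>, not the bare set of these products.\<close>

definition smult_prod ::
  "('r, 'a) ring_scheme \<Rightarrow> ('r, 'm, 'b) module_scheme \<Rightarrow> 'r set \<Rightarrow> 'm set \<Rightarrow> 'm set" where
  "smult_prod R M I N = (\<lambda>K. submodule K R M) hull {a \<odot>\<^bsub>M\<^esub> x | a x. a \<in> I \<and> x \<in> N}"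

definition residual ::
  "('r, 'a) ring_scheme \<Rightarrow> ('r, 'm, 'b) module_scheme \<Rightarrow> 'm set \<Rightarrow> 'r set" where
  "residual R M N = {r \<in> carrier R. \<forall>x \<in> carrier M. r \<odot>\<^bsub>M\<^esub> x \<in> N}"

definition annihilator :: "('r, 'a) ring_scheme \<Rightarrow> ('r, 'm, 'b) module_scheme \<Rightarrow> 'r set" where
  "annihilator R M = residual R M {\<zero>\<^bsub>M\<^esub>}"

definition J_submodule ::
  "'m set \<Rightarrow> ('r, 'a) ring_scheme \<Rightarrow> ('r, 'm, 'b) module_scheme \<Rightarrow> bool" where
  "J_submodule N R M \<longleftrightarrow>
     submodule N R M \<and> N \<noteq> carrier M \<and>
     (\<forall>r \<in> carrier R. \<forall>m \<in> carrier M.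
        r \<odot>\<^bsub>M\<^esub> m \<in> N \<and>
        r \<notin> residual R M (smult_prod R M (jacobson_radical R) (carrier M)) \<longrightarrow> m \<in> N)"

definition weakly_J_submodule ::
  "'m set \<Rightarrow> ('r, 'a) ring_scheme \<Rightarrow> ('r, 'm, 'b) module_scheme \<Rightarrow> bool" where
  "weakly_J_submodule N R M \<longleftrightarrow>
     submodule N R M \<and> N \<noteq> carrier M \<and>
     (\<forall>r \<in> carrier R. \<forall>m \<in> carrier M.
        r \<odot>\<^bsub>M\<^esub> m \<noteq> \<zero>\<^bsub>M\<^esub> \<and> r \<odot>\<^bsub>M\<^esub> m \<in> N \<and>
        r \<notin> residual R M (smult_prod R M (jacobson_radical R) (carrier M)) \<longrightarrow> m \<in> N)"

end

theory Submission
  imports Defs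
begin

text \<open>Write \<open>P = J(R)M\<close>. If \<open>N\<close> is weakly \<open>J\<close> but not \<open>J\<close>, the failure is witnessed by
  some \<open>r \<notin> (P : M)\<close> and \<open>m \<notin> N\<close> with \<open>r m \<in> N\<close>, and the weak condition forces \<open>r m = 0\<close>.
  The point is that this witness may be perturbed. For \<open>a \<in> (N : M)\<close> and \<open>n \<in> N\<close>, still
  \<open>r + a \<notin> (P : M)\<close>, because \<open>(N : M) \<subseteq> (P : M)\<close>, and \<open>m + n \<notin> N\<close>, while
  \<open>(r + a)(m + n) = r m + r n + a m + a n\<close> stays in \<open>N\<close>. The weak condition therefore kills every perturbed product. Perturbing only
  \<open>m\<close> gives \<open>r n = 0\<close>, perturbing only \<open>r\<close> gives \<open>a m = 0\<close>, and perturbing both then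
  leaves \<open>a n = 0\<close>, which is \<open>(N : M) N = 0\<close>.

  For the square of \<open>(N : M)\<close>, note that \<open>(a b) x = a (b x)\<close> with \<open>b x \<in> N\<close>, and that the
  annihilator, being the residual of a submodule, is closed under sums. The perturbation
  argument works for any submodule \<open>P\<close> containing \<open>N\<close> and is stated in that generality.\<close>

context module
begin

lemma submodule_zero_closed: "submodule N R M \<Longrightarrow> \<zero>\<^bsub>M\<^esub> \<in> N"
  using subgroup.one_closed[OF submodule.axioms(1)] by fastforce

lemma zero_submodule: "submodule {\<zero>\<^bsub>M\<^esub>} R M"
  by (rule submoduleI) (auto simp: smult_r_null)

lemma submodule_add_cancel_left:
  assumes N: "submodule N R M" and x: "x \<in> carrier M" and y: "y \<in> N" and "y \<oplus>\<^bsub>M\<^esub> x \<in> N"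
  shows "x \<in> N"
proof -
  have yM: "y \<in> carrier M" using submoduleE(1)[OF N] y by blast
  have "x = \<ominus>\<^bsub>M\<^esub> y \<oplus>\<^bsub>M\<^esub> (y \<oplus>\<^bsub>M\<^esub> x)"
    using x yM by (simp add: M.r_neg1)
  moreover have "\<ominus>\<^bsub>M\<^esub> y \<oplus>\<^bsub>M\<^esub> (y \<oplus>\<^bsub>M\<^esub> x) \<in> N"
    using submoduleE(3,5)[OF N] assms by blast
  ultimately show ?thesis by simp
qed

lemma submodule_Inter:
  assumes sub: "\<And>K. K \<in> \<K> \<Longrightarrow> submodule K R M" and ne: "\<K> \<noteq> {}"
  shows "submodule (\<Inter>\<K>) R M"
proof (rule submoduleI)
  show "\<Inter>\<K> \<subseteq> carrier M" using submoduleE(1)[OF sub] ne by blast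
qed (use sub in \<open>auto simp: submodule_zero_closed intro: submoduleE\<close>)

text \<open>The generating set has to lie in the carrier: otherwise no submodule contains it and the
  hull is an empty intersection.\<close>

lemma submodule_smult_prod:
  assumes "I \<subseteq> carrier R" "N \<subseteq> carrier M"
  shows "submodule (smult_prod R M I N) R M"
proof -
  have "{a \<odot>\<^bsub>M\<^esub> x | a x. a \<in> I \<and> x \<in> N} \<subseteq> carrier M"
    using assms by auto
  then show ?thesis
    unfolding smult_prod_def hull_def
    by (intro submodule_Inter) (use carrier_is_submodule in auto)
qed

lemma smult_prod_eq_zero:
  assumes "\<And>a x. a \<in> I \<Longrightarrow> x \<in> N \<Longrightarrow> a \<odot>\<^bsub>M\<^esub> x = \<zero>\<^bsub>M\<^esub>"
  shows "smult_prod R M I N = {\<zero>\<^bsub>M\<^esub>}"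
  unfolding smult_prod_def
  by (rule hull_unique) (use assms zero_submodule submodule_zero_closed in auto)

lemma residual_add_closed:
  assumes "submodule N R M" "a \<in> residual R M N" "b \<in> residual R M N"
  shows "a \<oplus>\<^bsub>R\<^esub> b \<in> residual R M N"
  using assms submoduleE(5)[OF assms(1)]
  by (simp add: residual_def smult_l_distr)

lemma residual_add_cancel_right:
  assumes N: "submodule N R M" and r: "r \<in> carrier R"
    and a: "a \<in> residual R M N" and "r \<oplus>\<^bsub>R\<^esub> a \<in> residual R M N"
  shows "r \<in> residual R M N"
proof -
  have "r \<odot>\<^bsub>M\<^esub> x \<in> N" if x: "x \<in> carrier M" for x
  proof (rule submodule_add_cancel_left[OF N, where y = "a \<odot>\<^bsub>M\<^esub> x"])
    show "a \<odot>\<^bsub>M\<^esub> x \<oplus>\<^bsub>M\<^esub> r \<odot>\<^bsub>M\<^esub> x \<in> N"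
      using assms x by (simp add: residual_def smult_l_distr M.a_comm)
  qed (use r a x in \<open>auto simp: residual_def\<close>)
  then show ?thesis using r by (simp add: residual_def)
qed

text \<open>The assumption \<open>weak\<close> is the weak \<open>J\<close>-condition, with \<open>P\<close>
  in place of \<open>J(R)M\<close>; it is applied to the pairs \<open>(r, m + n)\<close>, \<open>(r + a, m)\<close> and
  \<open>(r + a, m + n)\<close>, each of which is again a witness against the full \<open>J\<close>-condition.\<close>

lemma residual_smult_eq_zero:
  assumes N: "submodule N R M" and P: "submodule P R M" and NP: "N \<subseteq> P"
    and weak: "\<And>r m. \<lbrakk>r \<in> carrier R; m \<in> carrier M; r \<odot>\<^bsub>M\<^esub> m \<noteq> \<zero>\<^bsub>M\<^esub>; r \<odot>\<^bsub>M\<^esub> m \<in> N;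
                r \<notin> residual R M P\<rbrakk> \<Longrightarrow> m \<in> N"
    and r: "r \<in> carrier R" "r \<notin> residual R M P"
    and m: "m \<in> carrier M" "m \<notin> N" and rmN: "r \<odot>\<^bsub>M\<^esub> m \<in> N"
    and a: "a \<in> residual R M N" and n: "n \<in> N"
  shows "a \<odot>\<^bsub>M\<^esub> n = \<zero>\<^bsub>M\<^esub>"
proof -
  have aR: "a \<in> carrier R" and aN: "\<And>x. x \<in> carrier M \<Longrightarrow> a \<odot>\<^bsub>M\<^esub> x \<in> N"
    using a by (auto simp: residual_def)
  have nM: "n \<in> carrier M" using submoduleE(1)[OF N] n by blast
  have rnN: "r \<odot>\<^bsub>M\<^esub> n \<in> N" using submoduleE(4)[OF N] r n by blast
  have ra: "r \<oplus>\<^bsub>R\<^esub> a \<in> carrier R" "r \<oplus>\<^bsub>R\<^esub> a \<notin> residual R M P"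
  proof -
    have "a \<in> residual R M P" using a NP by (auto simp: residual_def)
    then show "r \<oplus>\<^bsub>R\<^esub> a \<notin> residual R M P"
      using residual_add_cancel_right[OF P] r by blast
  qed (use r aR in simp)
  have mn: "m \<oplus>\<^bsub>M\<^esub> n \<in> carrier M" "m \<oplus>\<^bsub>M\<^esub> n \<notin> N"
  proof -
    show "m \<oplus>\<^bsub>M\<^esub> n \<notin> N"
      using submodule_add_cancel_left[OF N m(1) n] m nM by (auto simp: M.a_comm)
  qed (use m nM in simp)
  have rm: "r \<odot>\<^bsub>M\<^esub> m = \<zero>\<^bsub>M\<^esub>"
    using weak r m rmN by blast
  have "r \<odot>\<^bsub>M\<^esub> (m \<oplus>\<^bsub>M\<^esub> n) = r \<odot>\<^bsub>M\<^esub> n"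
    using r m nM rm by (simp add: smult_r_distr)
  then have rn: "r \<odot>\<^bsub>M\<^esub> n = \<zero>\<^bsub>M\<^esub>"
    using weak r mn rnN by metis
  have "(r \<oplus>\<^bsub>R\<^esub> a) \<odot>\<^bsub>M\<^esub> m = a \<odot>\<^bsub>M\<^esub> m"
    using r m aR rm by (simp add: smult_l_distr)
  then have am: "a \<odot>\<^bsub>M\<^esub> m = \<zero>\<^bsub>M\<^esub>"
    using weak ra m aN by metis
  have "(r \<oplus>\<^bsub>R\<^esub> a) \<odot>\<^bsub>M\<^esub> (m \<oplus>\<^bsub>M\<^esub> n) = a \<odot>\<^bsub>M\<^esub> n"
    using r m aR nM rm rn am by (simp add: smult_l_distr smult_r_distr)
  then show ?thesis
    using weak ra mn aN nM by metis
qed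

lemma ideal_prod_residual_subset_annihilator:
  assumes "\<And>a n. a \<in> residual R M N \<Longrightarrow> n \<in> N \<Longrightarrow> a \<odot>\<^bsub>M\<^esub> n = \<zero>\<^bsub>M\<^esub>"
  shows "ideal_prod R (residual R M N) (residual R M N) \<subseteq> annihilator R M"
proof
  fix s assume "s \<in> ideal_prod R (residual R M N) (residual R M N)"
  then show "s \<in> annihilator R M"
  proof induction
    case (prod a b)
    then show ?case
      using assms[OF prod(1)] by (auto simp: annihilator_def residual_def smult_assoc1)
  next
    case (sum s t)
    then show ?case
      unfolding annihilator_def by (intro residual_add_closed[OF zero_submodule])
  qed
qed

end

theorem lemma1:
  fixes R :: "('r, 'a) ring_scheme"
    and M :: "('r, 'm, 'b) module_scheme"
    and N :: "'m set"
  assumes "module R M"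
    and "weakly_J_submodule N R M"
    and "N \<subseteq> smult_prod R M (jacobson_radical R) (carrier M)"
  shows "(\<not> J_submodule N R M \<longrightarrow>
            smult_prod R M (residual R M N) N = {\<zero>\<^bsub>M\<^esub>} \<and>
            ideal_prod R (residual R M N) (residual R M N) \<subseteq> annihilator R M) \<and>
         (smult_prod R M (residual R M N) N \<noteq> {\<zero>\<^bsub>M\<^esub>} \<longrightarrow> J_submodule N R M)"
proof -
  interpret module R M by fact
  let ?P = "smult_prod R M (jacobson_radical R) (carrier M)"
  have N: "submodule N R M"
    using assms(2) by (simp add: weakly_J_submodule_def)
  have P: "submodule ?P R M"
    by (rule submodule_smult_prod) (auto simp: jacobson_radical_def)
  have "a \<odot>\<^bsub>M\<^esub> n = \<zero>\<^bsub>M\<^esub>"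
    if notJ: "\<not> J_submodule N R M" and an: "a \<in> residual R M N" "n \<in> N" for a n
  proof -
    obtain r m where rm: "r \<in> carrier R" "r \<notin> residual R M ?P"
        "m \<in> carrier M" "m \<notin> N" "r \<odot>\<^bsub>M\<^esub> m \<in> N"
      using notJ assms(2) unfolding J_submodule_def weakly_J_submodule_def by blast
    show ?thesis
      by (rule residual_smult_eq_zero[OF N P assms(3) _ rm an])
        (use assms(2) in \<open>unfold weakly_J_submodule_def, blast\<close>)
  qed
  then show ?thesis
    using smult_prod_eq_zero ideal_prod_residual_subset_annihilator by metis
qed

end
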